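(* (Generalized Taylor theorem with the Lagrange form of the remainder term) Let $\{f,h\}\subset C^{n+1}[x_{0},b]$ and $f(x)\neq 0$ for all $x\in[x_0,b]$. Let $\gamma_k(h)$ be the generalized derivatives of $h$ and $\psi_k$ the recursive integrals with base point $x_0$, both associated with $f$ (as defined in the context). Then for any $x\in[x_{0},b]$ there exists a number $c$ between $x_{0}$ and $x$ such that $$h(x)=\sum_{k=0}^{n}\frac{\gamma_{k}(h)(x_{0})}{k!}\,\psi_{k}(x)+\frac{\gamma_{n+1}(h)(c)}{(n+1)!}\,\psi_{n+1}(x).$$
   Context: Recursive integrals: $\widetilde{X}^{(0)}(x)\equiv X^{(0)}(x)\equiv 1$ and, for $m\geq 1$, $$\widetilde{X}^{(m)}(x)=m\int_{x_{0}}^{x}\widetilde{X}^{(m-1)}(s)\left(f^{2}(s)\right)^{(-1)^{m-1}}\,ds,\qquad X^{(m)}(x)=m\int_{x_{0}}^{x}X^{(m-1)}(s)\left(f^{2}(s)\right)^{(-1)^{m}}\,ds .$$ Set $\psi_k=X^{(k)}$ if $k$ is odd and $\psi_k=\widetilde X^{(k)}$ if $k$ is even. Generalized derivatives (with respect to $f$): $\gamma_{0}(h)(x)=h(x)$ and, for $k=1,2,\ldots,n+1$, $$\gamma_{k}(h)(x)=\left(f^{2}(x)\right)^{(-1)^{k-1}}\big(\gamma_{k-1}(h)\big)'(x).$$ *)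

theory Defs
  imports "HOL-Analysis.Analysis"
begin

text \<open>The class \<open>C\<^sup>k(S)\<close>. Derivatives are taken within \<open>S\<close>, so that they are one-sided at the
  endpoints of a compact interval.\<close>

primrec Ck_on :: "nat \<Rightarrow> (real \<Rightarrow> real) \<Rightarrow> real set \<Rightarrow> bool" where
  "Ck_on 0 g S \<longleftrightarrow> continuous_on S g"
| "Ck_on (Suc k) g S \<longleftrightarrow>
     (\<exists>g'. (\<forall>x\<in>S. (g has_real_derivative g' x) (at x within S)) \<and> Ck_on k g' S)"

text \<open>\<open>rec_int_tilde f x0 m\<close> and \<open>rec_int f x0 m\<close> are the recursive integrals
  \<open>X\<close>-tilde and \<open>X\<close> of order \<open>m\<close>. The integral over \<open>{x0..x}\<close> is the oriented integral from \<open>x0\<close>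
  to \<open>x\<close> only for \<open>x0 \<le> x\<close>; they are meant to be used only to the right of the base point.\<close>

primrec rec_int_tilde :: "(real \<Rightarrow> real) \<Rightarrow> real \<Rightarrow> nat \<Rightarrow> real \<Rightarrow> real" where
  "rec_int_tilde f x0 0 = (\<lambda>x. 1)"
| "rec_int_tilde f x0 (Suc m) =
     (\<lambda>x. real (Suc m) *
        integral {x0..x} (\<lambda>s. rec_int_tilde f x0 m s * ((f s)\<^sup>2) powi ((-1) ^ m)))"

primrec rec_int :: "(real \<Rightarrow> real) \<Rightarrow> real \<Rightarrow> nat \<Rightarrow> real \<Rightarrow> real" where
  "rec_int f x0 0 = (\<lambda>x. 1)"
| "rec_int f x0 (Suc m) =
     (\<lambda>x. real (Suc m) *
        integral {x0..x} (\<lambda>s. rec_int f x0 m s * ((f s)\<^sup>2) powi ((-1) ^ Suc m)))"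

definition psi :: "(real \<Rightarrow> real) \<Rightarrow> real \<Rightarrow> nat \<Rightarrow> real \<Rightarrow> real" where
  "psi f x0 k = (if odd k then rec_int f x0 k else rec_int_tilde f x0 k)"

text \<open>\<open>gen_deriv f S k h\<close> is the generalized derivative of \<open>h\<close> of order \<open>k\<close> with respect to \<open>f\<close>,
  again with derivatives taken within \<open>S\<close>.\<close>

primrec gen_deriv :: "(real \<Rightarrow> real) \<Rightarrow> real set \<Rightarrow> nat \<Rightarrow> (real \<Rightarrow> real) \<Rightarrow> real \<Rightarrow> real" where
  "gen_deriv f S 0 h = h"
| "gen_deriv f S (Suc k) h =
     (\<lambda>x. ((f x)\<^sup>2) powi ((-1) ^ k) * vector_derivative (gen_deriv f S k h) (at x within S))"

end

theory Submission
  imports Defs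
begin

text \<open>Write \<open>p = f\<^sup>2\<close> and \<open>g\<^sub>k\<close> for the generalized derivative of \<open>h\<close> of order \<open>k\<close>. By definition
  \<open>g\<^sub>k' = w\<^sub>k * g\<^bsub>k+1\<^esub>\<close> with the positive weight \<open>w\<^sub>k\<close> equal to \<open>1/p\<close> for even \<open>k\<close> and to \<open>p\<close> for odd
  \<open>k\<close>. Polynomials in Taylor's theorem are replaced by the iterated integrals of the weights,
  \<open>I\<^sub>m\<^sub>m = 1\<close> and \<open>I\<^sub>j\<^sub>m(x)\<close> the integral of \<open>w\<^sub>j * I\<^bsub>j+1,m\<^esub>\<close> from \<open>x0\<close> to \<open>x\<close>; they play the role
  of \<open>(x - x0)^(m - j) / (m - j)!\<close>.

  The recursive integrals are such iterated integrals in disguise. Their outermost weight depends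
  on the number of integrations, whereas that of \<open>I\<^sub>j\<^sub>m\<close> depends on \<open>j\<close>. The alternation of the
  weights reconciles the two once the family is chosen by the parity of \<open>m\<close>: \<open>I\<^sub>j\<^sub>m\<close> is the
  recursive integral of order \<open>m - j\<close>, without tilde for odd \<open>m\<close> and with tilde for even \<open>m\<close>,
  divided by \<open>(m - j)!\<close>. For \<open>j = 0\<close> this is \<open>\<psi>\<^sub>m / m!\<close>, which explains the definition of \<open>\<psi>\<close>.

  The expansion
  \<open>g\<^sub>j(x) = (\<Sum>k=j..n. g\<^sub>k(x0) * I\<^sub>j\<^sub>k(x)) + g\<^bsub>n+1\<^esub>(c) * I\<^bsub>j,n+1\<^esub>(x)\<close> is proved by downward induction on
  \<open>j\<close>, starting from the trivial case \<open>j = n + 1\<close> with \<open>c = x\<close>. The remainder at level \<open>j\<close> and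
  \<open>I\<^bsub>j,n+1\<^esub>\<close> both vanish at \<open>x0\<close>, and their derivatives are \<open>w\<^sub>j\<close> times the corresponding functions
  at level \<open>j + 1\<close>. By Cauchy's mean value theorem their quotient at \<open>x\<close> is the quotient of the
  functions at level \<open>j + 1\<close> at an intermediate point, which the induction hypothesis identifies
  as a value of \<open>g\<^bsub>n+1\<^esub>\<close>. Only \<open>j = 0\<close> is wanted in the end.

  The remaining work is regularity. The generalized derivatives of \<open>h\<close> are differentiable up to
  order \<open>n\<close> because the classes \<open>C\<^sup>k\<close> are closed under products and reciprocals.\<close>

section \<open>Mean values of weighted derivatives\<close>

text \<open>Cauchy's mean value theorem for derivatives with a common positive factor \<open>w\<close>, which cancels.
  Avoiding quotients makes the case of a vanishing \<open>G\<close> or \<open>v\<close> harmless.\<close>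

lemma weighted_Cauchy_mean_value:
  fixes F G u v w :: "real \<Rightarrow> real"
  assumes "a < x" "x \<le> b"
    and F: "\<And>t. t \<in> {a..b} \<Longrightarrow> (F has_real_derivative w t * u t) (at t within {a..b})"
    and G: "\<And>t. t \<in> {a..b} \<Longrightarrow> (G has_real_derivative w t * v t) (at t within {a..b})"
    and w: "\<And>t. t \<in> {a..b} \<Longrightarrow> w t > 0"
    and "F a = 0" "G a = 0"
  shows "\<exists>c. a < c \<and> c < x \<and> F x * v c = G x * u c"
proof -
  define \<phi> where "\<phi> t = F t * G x - F x * G t" for t
  have \<phi>: "(\<phi> has_real_derivative w t * (u t * G x - F x * v t)) (at t within {a..b})"
    if "t \<in> {a..b}" for t
    unfolding \<phi>_def using that
    by (auto intro!: derivative_eq_intros F G simp: algebra_simps)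
  have "continuous_on {a..b} \<phi>"
    using \<phi> by (meson DERIV_continuous continuous_on_eq_continuous_within)
  then have cont: "continuous_on {a..x} \<phi>"
    by (rule continuous_on_subset) (use assms in auto)
  have der: "(\<phi> has_derivative (*) (w t * (u t * G x - F x * v t))) (at t)"
    if "a < t" "t < x" for t
    using \<phi>[of t] that assms(2) at_within_Icc_at[of a t b]
    by (simp add: has_field_derivative_def)
  obtain c where c: "a < c" "c < x" and eq: "\<phi> x - \<phi> a = w c * (u c * G x - F x * v c) * (x - a)"
    using mvt[OF \<open>a < x\<close> cont der] by auto
  have "w c > 0" using w[of c] c assms(2) by auto
  with eq c \<open>a < x\<close> assms(6,7) have "u c * G x - F x * v c = 0"
    by (simp add: \<phi>_def)
  with c show ?thesis by (auto simp: algebra_simps)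
qed

text \<open>An array \<open>I j m\<close> of functions with these properties is the array of iterated integrals from
  the introduction.\<close>

lemma iterated_integral_pos:
  fixes w :: "nat \<Rightarrow> real \<Rightarrow> real" and I :: "nat \<Rightarrow> nat \<Rightarrow> real \<Rightarrow> real"
  assumes w: "\<And>k t. t \<in> {a..b} \<Longrightarrow> w k t > 0"
    and I_diag: "\<And>m t. I m m t = 1"
    and I_base: "\<And>j m. j < m \<Longrightarrow> I j m a = 0"
    and I_deriv: "\<And>j m t. j < m \<Longrightarrow> t \<in> {a..b} \<Longrightarrow>
      (I j m has_real_derivative w j t * I (Suc j) m t) (at t within {a..b})"
    and "j \<le> m" "a < x" "x \<le> b"
  shows "I j m x > 0"
  using \<open>j \<le> m\<close> \<open>a < x\<close> \<open>x \<le> b\<close>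
proof (induction arbitrary: x rule: inc_induct)
  case base
  then show ?case by (simp add: I_diag)
next
  case (step j)
  have "continuous_on {a..b} (I j m)"
    using I_deriv[OF \<open>j < m\<close>] by (meson DERIV_continuous continuous_on_eq_continuous_within)
  then have cont: "continuous_on {a..x} (I j m)"
    by (rule continuous_on_subset) (use step.prems in auto)
  have "I j m a < I j m x"
  proof (rule DERIV_pos_imp_increasing_open[OF \<open>a < x\<close> _ cont])
    fix t assume t: "a < t" "t < x"
    then have "(I j m has_real_derivative w j t * I (Suc j) m t) (at t)"
      using I_deriv[OF \<open>j < m\<close>, of t] step.prems at_within_Icc_at[of a t b] by simp
    moreover have "w j t * I (Suc j) m t > 0"
      using step.IH[of t] w[of t j] t step.prems by simp
    ultimately show "\<exists>y. (I j m has_real_derivative y) (at t) \<and> y > 0" by blast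
  qed
  then show ?case using I_base[OF \<open>j < m\<close>] by simp
qed

text \<open>The induction needs the expansion of every \<open>g j\<close>, since an expansion of \<open>g (Suc j)\<close>
  at the intermediate point is what turns Cauchy's theorem into an expansion of \<open>g j\<close>. The
  induction starts with \<open>c = x\<close>; the first application of Cauchy's theorem moves \<open>c\<close> strictly to
  the left of \<open>x\<close>, hence the condition on \<open>j\<close>.\<close>

lemma weighted_Taylor_Lagrange:
  fixes g w :: "nat \<Rightarrow> real \<Rightarrow> real" and I :: "nat \<Rightarrow> nat \<Rightarrow> real \<Rightarrow> real"
  assumes g: "\<And>k t. k \<le> n \<Longrightarrow> t \<in> {a..b} \<Longrightarrow>
      (g k has_real_derivative w k t * g (Suc k) t) (at t within {a..b})"
    and w: "\<And>k t. t \<in> {a..b} \<Longrightarrow> w k t > 0"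
    and I_diag: "\<And>m t. I m m t = 1"
    and I_base: "\<And>j m. j < m \<Longrightarrow> I j m a = 0"
    and I_deriv: "\<And>j m t. j < m \<Longrightarrow> t \<in> {a..b} \<Longrightarrow>
      (I j m has_real_derivative w j t * I (Suc j) m t) (at t within {a..b})"
    and "j \<le> Suc n" "x \<in> {a..b}"
  shows "\<exists>c\<in>{a..x}. (a < x \<longrightarrow> a < c \<and> (j \<le> n \<longrightarrow> c < x)) \<and>
    g j x = (\<Sum>k=j..n. g k a * I j k x) + g (Suc n) c * I j (Suc n) x"
  using \<open>j \<le> Suc n\<close> \<open>x \<in> {a..b}\<close>
proof (induction arbitrary: x rule: inc_induct)
  case base
  then show ?case by (intro bexI[of _ x]) (auto simp: I_diag)
next
  case (step j)
  then have jn: "j \<le> n" by simp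
  have split: "(\<Sum>k=j..n. g k a * I j k t) = g j a + (\<Sum>k=Suc j..n. g k a * I j k t)" for t
    using jn by (simp add: sum.atLeast_Suc_atMost I_diag)
  have sum0: "(\<Sum>k=Suc j..n. g k a * I j k a) = 0"
    by (rule sum.neutral) (auto simp: I_base)
  show ?case
  proof (cases "a < x")
    case False
    with step.prems have "x = a" by auto
    then show ?thesis
      using I_base[of j "Suc n"] jn sum0 by (intro bexI[of _ a]) (auto simp: split)
  next
    case True
    define F where "F t = g j t - (\<Sum>k=j..n. g k a * I j k t)" for t
    define u where "u t = g (Suc j) t - (\<Sum>k=Suc j..n. g k a * I (Suc j) k t)" for t
    have F: "(F has_real_derivative w j t * u t) (at t within {a..b})" if t: "t \<in> {a..b}" for t
    proof -
      have "((\<lambda>t. g j t - (g j a + (\<Sum>k=Suc j..n. g k a * I j k t))) has_real_derivative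
          w j t * g (Suc j) t - (0 + (\<Sum>k=Suc j..n. g k a * (w j t * I (Suc j) k t))))
          (at t within {a..b})"
        by (intro DERIV_diff DERIV_add DERIV_sum DERIV_cmult DERIV_const g I_deriv jn t) auto
      moreover have "w j t * g (Suc j) t - (0 + (\<Sum>k=Suc j..n. g k a * (w j t * I (Suc j) k t)))
          = w j t * u t"
        by (simp add: u_def algebra_simps sum_distrib_left)
      ultimately show ?thesis by (simp add: F_def[abs_def] split)
    qed
    have "F a = 0" by (simp add: F_def split sum0)
    with True step.prems jn obtain d where d: "a < d" "d < x"
      and mean: "F x * I (Suc j) (Suc n) d = I j (Suc n) x * u d"
      using weighted_Cauchy_mean_value
        [where F = F and G = "I j (Suc n)" and w = "w j" and u = u and v = "I (Suc j) (Suc n)",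
         OF _ _ F I_deriv w _ I_base]
      by auto
    have "d \<in> {a..b}" using d step.prems by auto
    from step.IH[OF this] d(1)
    obtain c where c: "c \<in> {a..d}" "a < c"
      and "g (Suc j) d = (\<Sum>k=Suc j..n. g k a * I (Suc j) k d) + g (Suc n) c * I (Suc j) (Suc n) d"
      by blast
    then have ud: "u d = g (Suc n) c * I (Suc j) (Suc n) d" by (simp add: u_def)
    have "I (Suc j) (Suc n) d > 0"
      by (rule iterated_integral_pos[where I = I, OF w I_diag I_base I_deriv])
        (use d step.prems jn in auto)
    with mean ud have Fx: "F x = g (Suc n) c * I j (Suc n) x" by simp
    show ?thesis using c d Fx by (intro bexI[of _ c]) (auto simp: F_def algebra_simps)
  qed
qed

section \<open>Closure properties of \<open>C\<^sup>k\<close>\<close>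

lemma Ck_on_imp_continuous_on: "Ck_on k g S \<Longrightarrow> continuous_on S g"
  by (cases k) (auto simp: continuous_on_eq_continuous_within intro: DERIV_continuous)

lemma Ck_on_SucD: "Ck_on (Suc k) g S \<Longrightarrow> Ck_on k g S"
proof (induction k arbitrary: g)
  case 0
  then show ?case using Ck_on_imp_continuous_on by fastforce
next
  case (Suc k)
  then show ?case by (metis Ck_on.simps(2))
qed

lemma Ck_on_mono: "Ck_on k g S \<Longrightarrow> m \<le> k \<Longrightarrow> Ck_on m g S"
  by (induction k) (auto simp: le_Suc_eq simp del: Ck_on.simps dest: Ck_on_SucD)

lemma Ck_on_cong: "Ck_on k g S \<Longrightarrow> (\<And>x. x \<in> S \<Longrightarrow> g x = h x) \<Longrightarrow> Ck_on k h S"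
proof (cases k)
  case 0
  then show "Ck_on k g S \<Longrightarrow> (\<And>x. x \<in> S \<Longrightarrow> g x = h x) \<Longrightarrow> Ck_on k h S"
    using continuous_on_cong[of S S g h] by simp
next
  case (Suc m)
  assume "Ck_on k g S" and eq: "\<And>x. x \<in> S \<Longrightarrow> g x = h x"
  with Suc obtain g' where
    "\<And>x. x \<in> S \<Longrightarrow> (g has_real_derivative g' x) (at x within S)" "Ck_on m g' S" by auto
  with eq Suc show ?thesis
    by (auto intro!: exI[of _ g'] has_derivative_transform[of _ S h g]
        simp: has_field_derivative_def)
qed

lemma Ck_on_add: "Ck_on k g S \<Longrightarrow> Ck_on k h S \<Longrightarrow> Ck_on k (\<lambda>x. g x + h x) S"
proof (induction k arbitrary: g h)
  case 0
  then show ?case by (simp add: continuous_on_add)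
next
  case (Suc k)
  from Suc.prems obtain g' h' where
    "\<forall>x\<in>S. (g has_real_derivative g' x) (at x within S)" "Ck_on k g' S"
    "\<forall>x\<in>S. (h has_real_derivative h' x) (at x within S)" "Ck_on k h' S" by auto
  then show ?case
    by (auto intro!: exI[of _ "\<lambda>x. g' x + h' x"] DERIV_add Suc.IH)
qed

lemma Ck_on_uminus: "Ck_on k g S \<Longrightarrow> Ck_on k (\<lambda>x. - g x) S"
proof (induction k arbitrary: g)
  case 0
  then show ?case by (simp add: continuous_on_minus)
next
  case (Suc k)
  then obtain g' where
    "\<forall>x\<in>S. (g has_real_derivative g' x) (at x within S)" "Ck_on k g' S" by auto
  then show ?case
    by (auto intro!: exI[of _ "\<lambda>x. - g' x"] DERIV_minus Suc.IH)
qed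

lemma Ck_on_mult: "Ck_on k g S \<Longrightarrow> Ck_on k h S \<Longrightarrow> Ck_on k (\<lambda>x. g x * h x) S"
proof (induction k arbitrary: g h)
  case 0
  then show ?case by (simp add: continuous_on_mult)
next
  case (Suc k)
  from Suc.prems obtain g' h' where
    "\<forall>x\<in>S. (g has_real_derivative g' x) (at x within S)" "Ck_on k g' S"
    "\<forall>x\<in>S. (h has_real_derivative h' x) (at x within S)" "Ck_on k h' S" by auto
  then show ?case
    using Suc.prems[THEN Ck_on_SucD]
    by (auto intro!: exI[of _ "\<lambda>x. g' x * h x + h' x * g x"] DERIV_mult Ck_on_add Suc.IH)
qed

text \<open>The derivative \<open>- (g' * (1/g) * (1/g))\<close> of \<open>1/g\<close> involves \<open>1/g\<close> only to a lower order
  of smoothness, so the induction closes.\<close>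

lemma Ck_on_inverse:
  assumes "Ck_on k g S" "\<And>x. x \<in> S \<Longrightarrow> g x \<noteq> 0"
  shows "Ck_on k (\<lambda>x. inverse (g x)) S"
  using assms
proof (induction k)
  case 0
  then show ?case by (auto intro: continuous_on_inverse)
next
  case (Suc k)
  from Suc.prems obtain g' where
    g': "\<forall>x\<in>S. (g has_real_derivative g' x) (at x within S)" "Ck_on k g' S" by auto
  have "Ck_on k (\<lambda>x. inverse (g x)) S"
    using Suc.prems(2) by (rule Suc.IH[OF Ck_on_SucD[OF Suc.prems(1)]])
  with g' Suc.prems(2) show ?case
    by (auto intro!: exI[of _ "\<lambda>x. - (inverse (g x) * g' x * inverse (g x))"] DERIV_inverse'
        Ck_on_uminus Ck_on_mult)
qed

section \<open>The alternating weights\<close>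

lemma alternating_powi:
  fixes y :: real
  shows "y powi ((-1) ^ k) = (if even k then y else inverse y)"
  by (simp add: power_int_minus)

lemma Ck_on_alternating_powi:
  assumes "Ck_on k f S" "\<And>x. x \<in> S \<Longrightarrow> f x \<noteq> 0"
  shows "Ck_on k (\<lambda>x. ((f x)\<^sup>2) powi ((-1) ^ m)) S"
proof -
  have "Ck_on k (\<lambda>x. (f x)\<^sup>2) S"
    unfolding power2_eq_square by (intro Ck_on_mult assms)
  then show ?thesis
    using assms(2) by (cases "even m") (auto simp: alternating_powi intro!: Ck_on_inverse)
qed

section \<open>Generalized derivatives\<close>

lemma Ck_on_Suc_derivative:
  assumes "Ck_on (Suc m) g {a..b}" "a < b"
  shows "\<And>x. x \<in> {a..b} \<Longrightarrow>
      (g has_real_derivative vector_derivative g (at x within {a..b})) (at x within {a..b})"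
    and "Ck_on m (\<lambda>x. vector_derivative g (at x within {a..b})) {a..b}"
proof -
  from assms(1) obtain g' where
    g': "\<And>x. x \<in> {a..b} \<Longrightarrow> (g has_real_derivative g' x) (at x within {a..b})"
    and "Ck_on m g' {a..b}" unfolding Ck_on.simps by blast
  have eq: "vector_derivative g (at x within {a..b}) = g' x" if "x \<in> {a..b}" for x
    using vector_derivative_within_closed_interval[OF \<open>a < b\<close> that] g'[OF that]
    by (simp add: has_real_derivative_iff_has_vector_derivative)
  show "(g has_real_derivative vector_derivative g (at x within {a..b})) (at x within {a..b})"
    if "x \<in> {a..b}" for x
    using g'[OF that] eq[OF that] by simp
  show "Ck_on m (\<lambda>x. vector_derivative g (at x within {a..b})) {a..b}"
    using \<open>Ck_on m g' {a..b}\<close> by (rule Ck_on_cong) (simp add: eq)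
qed

text \<open>Every differentiation costs one order of smoothness. The weights introduced by earlier steps
  are differentiated along with \<open>h\<close>, so \<open>f\<close> has to be smooth as well.\<close>

lemma Ck_on_gen_deriv:
  assumes "a < b" "Ck_on (k + m) f {a..b}" "Ck_on (k + m) h {a..b}"
    and "\<And>x. x \<in> {a..b} \<Longrightarrow> f x \<noteq> 0"
  shows "Ck_on m (gen_deriv f {a..b} k h) {a..b}"
  using assms(2,3)
proof (induction k arbitrary: m)
  case 0
  then show ?case by simp
next
  case (Suc k)
  have "Ck_on (Suc m) (gen_deriv f {a..b} k h) {a..b}"
    using Suc.IH[of "Suc m"] Suc.prems by simp
  moreover have "Ck_on m f {a..b}"
    using Suc.prems(1) by (rule Ck_on_mono) simp
  ultimately show ?case
    using assms(1,4) unfolding gen_deriv.simps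
    by (intro Ck_on_mult Ck_on_alternating_powi Ck_on_Suc_derivative(2)) auto
qed

lemma gen_deriv_has_derivative:
  assumes "a < b" "Ck_on (Suc n) f {a..b}" "Ck_on (Suc n) h {a..b}"
    and nz: "\<And>x. x \<in> {a..b} \<Longrightarrow> f x \<noteq> 0" and "k \<le> n" "x \<in> {a..b}"
  shows "(gen_deriv f {a..b} k h has_real_derivative
      ((f x)\<^sup>2) powi ((-1) ^ Suc k) * gen_deriv f {a..b} (Suc k) h x) (at x within {a..b})"
proof -
  obtain m where "n = k + m" using \<open>k \<le> n\<close> le_Suc_ex by blast
  then have "Ck_on (Suc m) (gen_deriv f {a..b} k h) {a..b}"
    using assms by (intro Ck_on_gen_deriv) auto
  then have "(gen_deriv f {a..b} k h has_real_derivative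
      vector_derivative (gen_deriv f {a..b} k h) (at x within {a..b})) (at x within {a..b})"
    using assms by (intro Ck_on_Suc_derivative)
  moreover have "((f x)\<^sup>2) powi ((-1) ^ Suc k) * ((f x)\<^sup>2) powi ((-1) ^ k) = 1"
    using nz[OF \<open>x \<in> {a..b}\<close>] by (simp add: alternating_powi del: power_Suc)
  ultimately show ?thesis by (simp del: power_Suc flip: mult.assoc)
qed

section \<open>Recursive integrals as iterated integrals\<close>

lemma integral_multiple_has_derivative:
  fixes q :: "real \<Rightarrow> real"
  assumes "continuous_on {a..b} q" "x \<in> {a..b}"
  shows "((\<lambda>x. r * integral {a..x} q) has_real_derivative r * q x) (at x within {a..b})"
  by (intro DERIV_cmult integral_has_real_derivative assms)

lemma continuous_on_rec_int:
  assumes "\<And>i. continuous_on {a..b} (\<lambda>x. ((f x)\<^sup>2) powi ((-1) ^ i))"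
  shows "continuous_on {a..b} (rec_int_tilde f a m)" "continuous_on {a..b} (rec_int f a m)"
proof -
  show "continuous_on {a..b} (rec_int_tilde f a m)"
  proof (induction m)
    case (Suc m)
    have "continuous_on {a..b} (\<lambda>s. rec_int_tilde f a m s * ((f s)\<^sup>2) powi ((-1) ^ m))"
      by (intro continuous_on_mult Suc assms)
    from integral_multiple_has_derivative[OF this] show ?case
      unfolding continuous_on_eq_continuous_within rec_int_tilde.simps
      using DERIV_continuous by blast
  qed simp
  show "continuous_on {a..b} (rec_int f a m)"
  proof (induction m)
    case (Suc m)
    have "continuous_on {a..b} (\<lambda>s. rec_int f a m s * ((f s)\<^sup>2) powi ((-1) ^ Suc m))"
      by (intro continuous_on_mult Suc assms)
    from integral_multiple_has_derivative[OF this] show ?case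
      unfolding continuous_on_eq_continuous_within rec_int.simps
      using DERIV_continuous by blast
  qed simp
qed

text \<open>The family is selected by the parity of \<open>m\<close>, not of the order \<open>m - j\<close>: differentiation lowers
  the order and keeps the family.\<close>

definition iterated_integral :: "(real \<Rightarrow> real) \<Rightarrow> real \<Rightarrow> nat \<Rightarrow> nat \<Rightarrow> real \<Rightarrow> real" where
  "iterated_integral f a j m x =
     (if odd m then rec_int f a (m - j) x else rec_int_tilde f a (m - j) x) / fact (m - j)"

lemma iterated_integral_0: "iterated_integral f a 0 m x = psi f a m x / fact m"
  by (simp add: iterated_integral_def psi_def)

lemma iterated_integral_diag: "iterated_integral f a m m x = 1"
  by (simp add: iterated_integral_def)

lemma iterated_integral_base: "j < m \<Longrightarrow> iterated_integral f a j m a = 0"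
  by (cases "m - j") (auto simp: iterated_integral_def)

text \<open>Here the parities meet: the exponents \<open>(-1) ^ (m - j)\<close> for odd \<open>m\<close> and \<open>(-1) ^ (m - j - 1)\<close> for
  even \<open>m\<close> are both \<open>(-1) ^ (j + 1)\<close>, so the weight depends on \<open>j\<close> alone.\<close>

lemma iterated_integral_has_derivative:
  assumes cont: "\<And>i. continuous_on {a..b} (\<lambda>x. ((f x)\<^sup>2) powi ((-1) ^ i))"
    and "j < m" "x \<in> {a..b}"
  shows "(iterated_integral f a j m has_real_derivative
      ((f x)\<^sup>2) powi ((-1) ^ Suc j) * iterated_integral f a (Suc j) m x) (at x within {a..b})"
proof -
  define i where "i = m - Suc j"
  with \<open>j < m\<close> have m: "m = Suc (i + j)" by simp
  have order: "m - j = Suc i" "m - Suc j = i" using m by auto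
  have fact: "real (Suc i) / fact (Suc i) = 1 / fact i" by (simp add: fact_Suc del: of_nat_Suc)
  show ?thesis
  proof (cases "odd m")
    case True
    have eq: "iterated_integral f a j m = (\<lambda>x. real (Suc i) / fact (Suc i) *
        integral {a..x} (\<lambda>s. rec_int f a i s * ((f s)\<^sup>2) powi ((-1) ^ Suc i)))"
      by (rule ext) (simp add: iterated_integral_def True order)
    have par: "((-1) ^ Suc i :: int) = (-1) ^ Suc j"
      using True m by (auto simp: minus_one_power_iff)
    have "(iterated_integral f a j m has_real_derivative
        real (Suc i) / fact (Suc i) * (rec_int f a i x * ((f x)\<^sup>2) powi ((-1) ^ Suc i)))
        (at x within {a..b})"
      unfolding eq
      by (intro integral_multiple_has_derivative continuous_on_mult continuous_on_rec_int cont assms)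
    then show ?thesis
      unfolding fact par by (simp add: iterated_integral_def True order mult.commute del: power_Suc)
  next
    case False
    have eq: "iterated_integral f a j m = (\<lambda>x. real (Suc i) / fact (Suc i) *
        integral {a..x} (\<lambda>s. rec_int_tilde f a i s * ((f s)\<^sup>2) powi ((-1) ^ i)))"
      by (rule ext) (use False in \<open>simp add: iterated_integral_def order\<close>)
    have par: "((-1) ^ i :: int) = (-1) ^ Suc j"
      using False m by (auto simp: minus_one_power_iff)
    have "(iterated_integral f a j m has_real_derivative
        real (Suc i) / fact (Suc i) * (rec_int_tilde f a i x * ((f x)\<^sup>2) powi ((-1) ^ i)))
        (at x within {a..b})"
      unfolding eq
      by (intro integral_multiple_has_derivative continuous_on_mult continuous_on_rec_int cont assms)
    then show ?thesis
      unfolding fact par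
      using False by (simp add: iterated_integral_def order mult.commute del: power_Suc)
  qed
qed

section \<open>The generalized Taylor theorem\<close>

theorem theorem11:
  fixes f h :: "real \<Rightarrow> real" and x0 b :: real and n :: nat
  assumes "x0 < b"
    and "Ck_on (Suc n) f {x0..b}"
    and "Ck_on (Suc n) h {x0..b}"
    and "\<forall>x\<in>{x0..b}. f x \<noteq> 0"
  shows "\<forall>x\<in>{x0..b}. \<exists>c\<in>{x0..x}. (x0 < x \<longrightarrow> x0 < c \<and> c < x) \<and>
    h x = (\<Sum>k=0..n. gen_deriv f {x0..b} k h x0 / fact k * psi f x0 k x)
          + gen_deriv f {x0..b} (Suc n) h c / fact (Suc n) * psi f x0 (Suc n) x"
proof
  fix x assume x: "x \<in> {x0..b}"
  define g where "g k = gen_deriv f {x0..b} k h" for k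
  define w where "w k t = ((f t)\<^sup>2) powi ((-1) ^ Suc k)" for k t
  have nz: "\<And>t. t \<in> {x0..b} \<Longrightarrow> f t \<noteq> 0" using assms(4) by blast
  have cont: "continuous_on {x0..b} (\<lambda>t. ((f t)\<^sup>2) powi ((-1) ^ i))" for i
    using assms(2) nz by (intro Ck_on_imp_continuous_on Ck_on_alternating_powi)
  have "\<exists>c\<in>{x0..x}. (x0 < x \<longrightarrow> x0 < c \<and> (0 \<le> n \<longrightarrow> c < x)) \<and>
    g 0 x = (\<Sum>k=0..n. g k x0 * iterated_integral f x0 0 k x)
      + g (Suc n) c * iterated_integral f x0 0 (Suc n) x"
  proof (rule weighted_Taylor_Lagrange[where w = w])
    show "(g k has_real_derivative w k t * g (Suc k) t) (at t within {x0..b})"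
      if "k \<le> n" "t \<in> {x0..b}" for k t
      unfolding g_def w_def using assms(1-3) nz that by (rule gen_deriv_has_derivative)
    show "w k t > 0" if "t \<in> {x0..b}" for k t
      unfolding w_def using nz[OF that] by (intro zero_less_power_int) simp
    show "(iterated_integral f x0 j m has_real_derivative
        w j t * iterated_integral f x0 (Suc j) m t) (at t within {x0..b})"
      if "j < m" "t \<in> {x0..b}" for j m t
      unfolding w_def using cont that by (rule iterated_integral_has_derivative)
  qed (use x in \<open>simp_all add: iterated_integral_diag iterated_integral_base\<close>)
  then show "\<exists>c\<in>{x0..x}. (x0 < x \<longrightarrow> x0 < c \<and> c < x) \<and>
    h x = (\<Sum>k=0..n. gen_deriv f {x0..b} k h x0 / fact k * psi f x0 k x)
          + gen_deriv f {x0..b} (Suc n) h c / fact (Suc n) * psi f x0 (Suc n) x"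
    by (simp add: g_def iterated_integral_0 del: gen_deriv.simps(2) fact_Suc)
qed

end
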